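(* Let $M$ be a manifold and let $\theta,\eta$ be 1-forms on $M$ such that $\theta$ is closed. Define $\mathcal{H}_t:=\ker\theta$, $\mathcal{H}_z:=\ker\eta$ and $\mathcal{H}_{tz}:=\mathcal{H}_t\cap\mathcal{H}_z$. Further define $\mathcal{V}:=\ker d\eta$, and then $\mathcal{V}_t:=\mathcal{V}\cap\mathcal{H}_z$ and $\mathcal{V}_z:=\mathcal{V}\cap\mathcal{H}_t$. Assume also that $d\eta|_{\mathcal{H}_t}$ and $d\eta|_{\mathcal{H}_z}$ are degenerate on their respective domains. The following are equivalent: (1) $TM=\mathcal{H}_{tz}\oplus\mathcal{V}_t\oplus\mathcal{V}_z$. (2) $(\mathcal{H}_{tz},d\eta|_{\mathcal{H}_{tz}})$ is a weakly symplectic distribution. (3) The map $\flat_{\theta,\eta}\colon v\mapsto\theta(v)\theta+\iota_v d\eta+\eta(v)\eta$ is an injective bundle morphism $TM\to T'M$.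
   Context: Manifolds are modelled on convenient vector spaces (Hausdorff locally convex real topological vector spaces in which every smooth curve has a smooth antiderivative); smooth maps are those sending smooth curves to smooth curves. $TM$ is the kinematic tangent bundle (equivalence classes of smooth curves), and $T'M$ is the bundle with fibres the continuous duals $(T_pM)'$. $k$-forms are smooth sections of the bundle of continuous alternating $k$-linear forms on $TM$. For a 2-form $\omega$, $\ker\omega$ denotes the kernel of $v\mapsto\omega(v,\cdot)$; a 2-form is called degenerate if it has non-zero kernel. A distribution with an antisymmetric bilinear form $\Omega$ on its fibres is weakly symplectic if $\Omega$ is weakly non-degenerate on each fibre, i.e. $\Omega(v,\cdot)=0$ on the fibre implies $v=0$. (A triple $(M,\theta,\eta)$ satisfying the assumptions and any, hence all, of the conditions (1)–(3) is called a cocontact manifold.)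
   Formalization: Degeneracy of dη on H_t and H_z is taken to mean that ker dη ∩ H_t and ker dη ∩ H_z are non-zero at every point; with both arguments restricted the claim fails, e.g. θ=dt, η=e^t dz on R², where (2) and (3) hold but (1) does not. *)

theory Defs
  imports "HOL-Analysis.Analysis"
begin

text \<open>
  Convenient calculus in the sense of Frolicher--Kriegl and Kriegl--Michor, \<^emph>\<open>The Convenient Setting
  of Global Analysis\<close> (KM below).
\<close>

section \<open>Convenient vector spaces\<close>

class real_vector_t2 = real_vector + t2_space + topological_ab_group_add

definition (in real_vector_t2) has_curve_derivative :: "(real \<Rightarrow> 'a) \<Rightarrow> 'a \<Rightarrow> real \<Rightarrow> bool" where
  "has_curve_derivative c e t \<longleftrightarrow> ((\<lambda>h. (1 / h) *\<^sub>R (c (t + h) - c t)) \<longlongrightarrow> e) (at 0)"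

definition (in real_vector_t2) velocity :: "(real \<Rightarrow> 'a) \<Rightarrow> real \<Rightarrow> 'a" where
  "velocity c t = (THE e. has_curve_derivative c e t)"

text \<open>\<open>D n\<close> is the \<open>n\<close>-th derivative. Only used for open \<open>I\<close>; the values of \<open>c\<close> off \<open>I\<close> play no role.\<close>

definition (in real_vector_t2) smooth_curve_on :: "real set \<Rightarrow> (real \<Rightarrow> 'a) \<Rightarrow> bool" where
  "smooth_curve_on I c \<longleftrightarrow>
     (\<exists>D. D 0 = c \<and> (\<forall>n. \<forall>t\<in>I. has_curve_derivative (D n) (D (Suc n) t) t))"

instance real :: real_vector_t2 ..

text \<open>The conclusion of \<open>locally_convex\<close> spells out \<^const>\<open>convex\<close>.\<close>

class locally_convex_space = real_vector_t2 +
  assumes tendsto_scaleR_lcs: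
      "((\<lambda>(r, x). r *\<^sub>R x) \<longlongrightarrow> a *\<^sub>R y) (nhds a \<times>\<^sub>F nhds y)"
    and locally_convex:
      "open U \<Longrightarrow> 0 \<in> U \<Longrightarrow> \<exists>V. open V \<and> 0 \<in> V \<and> V \<subseteq> U \<and>
         (\<forall>x\<in>V. \<forall>y\<in>V. \<forall>r\<ge>0. \<forall>s\<ge>0. r + s = 1 \<longrightarrow> r *\<^sub>R x + s *\<^sub>R y \<in> V)"

class convenient_space = locally_convex_space +
  assumes smooth_antiderivative:
      "smooth_curve_on UNIV c \<Longrightarrow>
         \<exists>C. smooth_curve_on UNIV C \<and> (\<forall>t. has_curve_derivative C (c t) t)"

definition vn_bounded :: "'e::locally_convex_space set \<Rightarrow> bool" where
  "vn_bounded B \<longleftrightarrow> (\<forall>W. open W \<and> 0 \<in> W \<longrightarrow> (\<exists>r>0. \<forall>b\<in>B. r *\<^sub>R b \<in> W))"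

text \<open>
  Smoothness depends on the topology of a convenient space only through its bounded sets, and the
  differential of a smooth map is in general continuous only for the bornological topology, the
  finest locally convex topology with the given bounded sets. This is therefore the topology that
  a tangent space inherits from the model space independently of the chart, and the one with
  respect to which continuous duals are formed; it is the given topology if that is bornological.
\<close>

definition bornivorous_disk :: "'e::locally_convex_space set \<Rightarrow> bool" where
  "bornivorous_disk W \<longleftrightarrow>
     convex W \<and> (\<forall>w\<in>W. \<forall>a. \<bar>a\<bar> \<le> 1 \<longrightarrow> a *\<^sub>R w \<in> W) \<and>
     (\<forall>B. vn_bounded B \<longrightarrow> (\<exists>r>0. \<forall>b\<in>B. r *\<^sub>R b \<in> W))"

definition bornological_topology :: "'e::locally_convex_space topology" where
  "bornological_topology =
     topology (\<lambda>S. \<forall>x\<in>S. \<exists>W. bornivorous_disk W \<and> (\<forall>w\<in>W. x + w \<in> S))"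

lemma bornivorous_disk_Int:
  assumes "bornivorous_disk V" "bornivorous_disk W"
  shows "bornivorous_disk (V \<inter> W)"
  unfolding bornivorous_disk_def
proof (intro conjI allI impI)
  show "convex (V \<inter> W)"
    using assms by (simp add: bornivorous_disk_def convex_Int)
  show "\<forall>w\<in>V \<inter> W. \<forall>a. \<bar>a\<bar> \<le> 1 \<longrightarrow> a *\<^sub>R w \<in> V \<inter> W"
    using assms by (auto simp: bornivorous_disk_def)
  fix B :: "'a set" assume "vn_bounded B"
  then obtain r s where r: "r > 0" "\<forall>b\<in>B. r *\<^sub>R b \<in> V" and s: "s > 0" "\<forall>b\<in>B. s *\<^sub>R b \<in> W"
    using assms unfolding bornivorous_disk_def by meson
  let ?q = "min r s"
  have "?q *\<^sub>R b \<in> V \<inter> W" if "b \<in> B" for b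
  proof -
    have "\<bar>?q / r\<bar> \<le> 1" "\<bar>?q / s\<bar> \<le> 1"
      using r s by (auto simp: abs_le_iff divide_simps min_def)
    hence "(?q / r) *\<^sub>R (r *\<^sub>R b) \<in> V" "(?q / s) *\<^sub>R (s *\<^sub>R b) \<in> W"
      using assms r(2) s(2) that unfolding bornivorous_disk_def by blast+
    thus ?thesis using r s by auto
  qed
  thus "\<exists>r>0. \<forall>b\<in>B. r *\<^sub>R b \<in> V \<inter> W"
    using r s by (intro exI[of _ ?q]) auto
qed

lemma openin_bornological_topology:
  "openin bornological_topology S \<longleftrightarrow> (\<forall>x\<in>S. \<exists>W. bornivorous_disk W \<and> (\<forall>w\<in>W. x + w \<in> S))"
proof -
  have "istopology (\<lambda>S::'a set. \<forall>x\<in>S. \<exists>W. bornivorous_disk W \<and> (\<forall>w\<in>W. x + w \<in> S))"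
    unfolding istopology_def
  proof (intro conjI allI impI ballI)
    fix S T :: "'a set" and x
    assume "\<forall>x\<in>S. \<exists>W. bornivorous_disk W \<and> (\<forall>w\<in>W. x + w \<in> S)"
      and "\<forall>x\<in>T. \<exists>W. bornivorous_disk W \<and> (\<forall>w\<in>W. x + w \<in> T)" and "x \<in> S \<inter> T"
    then obtain V W where "bornivorous_disk V" "\<forall>w\<in>V. x + w \<in> S"
      "bornivorous_disk W" "\<forall>w\<in>W. x + w \<in> T" by blast
    thus "\<exists>W. bornivorous_disk W \<and> (\<forall>w\<in>W. x + w \<in> S \<inter> T)"
      by (intro exI[of _ "V \<inter> W"]) (auto intro: bornivorous_disk_Int)
  next
    fix K :: "'a set set" and x
    assume "\<forall>S\<in>K. \<forall>x\<in>S. \<exists>W. bornivorous_disk W \<and> (\<forall>w\<in>W. x + w \<in> S)" and "x \<in> \<Union>K"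
    thus "\<exists>W. bornivorous_disk W \<and> (\<forall>w\<in>W. x + w \<in> \<Union>K)" by (meson UnionE UnionI)
  qed
  thus ?thesis by (simp add: bornological_topology_def topology_inverse')
qed

definition continuous_dual :: "('e::locally_convex_space \<Rightarrow> real) set" where
  "continuous_dual = {l. linear l \<and> continuous_map bornological_topology euclideanreal l}"

section \<open>Manifolds\<close>

definition cinf_open :: "'e::convenient_space set \<Rightarrow> bool" where
  "cinf_open S \<longleftrightarrow> (\<forall>c. smooth_curve_on UNIV c \<longrightarrow> open (c -` S))"

definition smooth_map_on ::
    "'e::convenient_space set \<Rightarrow> ('e \<Rightarrow> 'f::convenient_space) \<Rightarrow> bool" where
  "smooth_map_on S f \<longleftrightarrow>
     (\<forall>I c. open I \<and> smooth_curve_on I c \<and> c ` I \<subseteq> S \<longrightarrow> smooth_curve_on I (f \<circ> c))"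

type_synonym ('m, 'e) chart = "'m set \<times> ('m \<Rightarrow> 'e)"
type_synonym ('m, 'e) atlas = "('m, 'e) chart set"

definition points :: "('m, 'e) atlas \<Rightarrow> 'm set" where
  "points A = (\<Union>(U, u)\<in>A. U)"

definition convenient_manifold :: "('m, 'e::convenient_space) atlas \<Rightarrow> bool" where
  "convenient_manifold A \<longleftrightarrow>
     (\<forall>(U, u)\<in>A. inj_on u U \<and> cinf_open (u ` U)) \<and>
     (\<forall>(U, u)\<in>A. \<forall>(V, v)\<in>A.
        cinf_open (u ` (U \<inter> V)) \<and> smooth_map_on (u ` (U \<inter> V)) (v \<circ> inv_into U u))"

definition smooth_path :: "('m, 'e::convenient_space) atlas \<Rightarrow> (real \<Rightarrow> 'm) \<Rightarrow> bool" where
  "smooth_path A c \<longleftrightarrow>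
     range c \<subseteq> points A \<and>
     (\<forall>(U, u)\<in>A. open (c -` U) \<and> smooth_curve_on (c -` U) (u \<circ> c))"

section \<open>The kinematic tangent bundle\<close>

type_synonym 'm tangent = "(real \<Rightarrow> 'm) set"

definition chart_at :: "('m, 'e) atlas \<Rightarrow> 'm \<Rightarrow> ('m, 'e) chart" where
  "chart_at A p = (SOME k. k \<in> A \<and> p \<in> fst k)"

definition paths_at :: "('m, 'e::convenient_space) atlas \<Rightarrow> 'm \<Rightarrow> (real \<Rightarrow> 'm) set" where
  "paths_at A p = {c. smooth_path A c \<and> c 0 = p}"

text \<open>By the chain rule, curves with equal velocities in one chart at \<open>p\<close> have so in all of them.\<close>

definition tangent_rel ::
    "('m, 'e::convenient_space) atlas \<Rightarrow> 'm \<Rightarrow> ((real \<Rightarrow> 'm) \<times> (real \<Rightarrow> 'm)) set" where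
  "tangent_rel A p =
     {(c, d). c \<in> paths_at A p \<and> d \<in> paths_at A p \<and>
        velocity (snd (chart_at A p) \<circ> c) 0 = velocity (snd (chart_at A p) \<circ> d) 0}"

definition tangent_space :: "('m, 'e::convenient_space) atlas \<Rightarrow> 'm \<Rightarrow> 'm tangent set" where
  "tangent_space A p = paths_at A p // tangent_rel A p"

text \<open>
  For a chart map \<open>u\<close> at \<open>p\<close>, \<open>e \<mapsto> tangent_of A u p e\<close> is the bijection from the model space to
  the tangent space at \<open>p\<close> given by \<open>u\<close>, that is, \<open>T u\<^sup>-\<^sup>1 (u p, e)\<close>. These maps carry the linear,
  topological and smooth structure of the model space over to the tangent bundle.
\<close>

definition tangent_of ::
    "('m, 'e::convenient_space) atlas \<Rightarrow> ('m \<Rightarrow> 'e) \<Rightarrow> 'm \<Rightarrow> 'e \<Rightarrow> 'm tangent" where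
  "tangent_of A u p e = {c \<in> paths_at A p. velocity (u \<circ> c) 0 = e}"

definition tangent_coord :: "('m \<Rightarrow> 'e::convenient_space) \<Rightarrow> 'm tangent \<Rightarrow> 'e" where
  "tangent_coord u X = velocity (u \<circ> (SOME c. c \<in> X)) 0"

definition tangent_zero :: "('m, 'e::convenient_space) atlas \<Rightarrow> 'm \<Rightarrow> 'm tangent" where
  "tangent_zero A p = tangent_of A (snd (chart_at A p)) p 0"

definition tangent_add ::
    "('m, 'e::convenient_space) atlas \<Rightarrow> 'm \<Rightarrow> 'm tangent \<Rightarrow> 'm tangent \<Rightarrow> 'm tangent" where
  "tangent_add A p X Y = (let u = snd (chart_at A p) in
     tangent_of A u p (tangent_coord u X + tangent_coord u Y))"

definition tangent_scale ::
    "('m, 'e::convenient_space) atlas \<Rightarrow> 'm \<Rightarrow> real \<Rightarrow> 'm tangent \<Rightarrow> 'm tangent" where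
  "tangent_scale A p r X = (let u = snd (chart_at A p) in
     tangent_of A u p (r *\<^sub>R tangent_coord u X))"

text \<open>Smoothness of the curve \<open>t \<mapsto> (c t, X t)\<close> in the tangent bundle.\<close>

definition smooth_path_tangent ::
    "('m, 'e::convenient_space) atlas \<Rightarrow> (real \<Rightarrow> 'm) \<Rightarrow> (real \<Rightarrow> 'm tangent) \<Rightarrow> bool" where
  "smooth_path_tangent A c X \<longleftrightarrow>
     smooth_path A c \<and> (\<forall>t. X t \<in> tangent_space A (c t)) \<and>
     (\<forall>(U, u)\<in>A. \<exists>e. smooth_curve_on (c -` U) e \<and>
        (\<forall>t\<in>c -` U. X t = tangent_of A u (c t) (e t)))"

section \<open>Cotangent bundle and differential forms\<close>

text \<open>
  (Multi)linear forms on a tangent space are functions on the ambient type; only their values on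
  tangent vectors matter.
\<close>

definition cotangent_space ::
    "('m, 'e::convenient_space) atlas \<Rightarrow> 'm \<Rightarrow> ('m tangent \<Rightarrow> real) set" where
  "cotangent_space A p =
     {l. \<forall>(U, u)\<in>A. p \<in> U \<longrightarrow> (\<lambda>e. l (tangent_of A u p e)) \<in> continuous_dual}"

text \<open>
  On convenient spaces, the separately continuous bilinear forms (for the bornological topologies)
  are the bounded ones (KM 5.19). Joint continuity is not required: it would exclude, for example,
  the differential of the canonical 1-form on the product of a non-normable space and its dual.
\<close>

definition alternating_forms ::
    "('m, 'e::convenient_space) atlas \<Rightarrow> 'm \<Rightarrow> ('m tangent \<Rightarrow> 'm tangent \<Rightarrow> real) set" where
  "alternating_forms A p =
     {b. (\<forall>X\<in>tangent_space A p.
           b X \<in> cotangent_space A p \<and> (\<lambda>Y. b Y X) \<in> cotangent_space A p \<and> b X X = 0)}"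

text \<open>
  The dual of the model space \<open>E\<close> carries the smooth structure of the closed subspace of linear
  functions in \<open>C\<^sup>\<infinity>(E, \<real>)\<close>. By cartesian closedness (KM 3.12, 3.17), a curve \<open>l\<close> in the dual is
  smooth iff \<open>(t, e) \<mapsto> l t e\<close> is, i.e.\ iff \<open>s \<mapsto> l (g s) (e s)\<close> is smooth for smooth \<open>g\<close> and \<open>e\<close>.
  The same holds for bilinear forms.
\<close>

definition smooth_path_cotangent ::
    "('m, 'e::convenient_space) atlas \<Rightarrow> (real \<Rightarrow> 'm) \<Rightarrow> (real \<Rightarrow> 'm tangent \<Rightarrow> real) \<Rightarrow> bool" where
  "smooth_path_cotangent A c l \<longleftrightarrow>
     smooth_path A c \<and> (\<forall>t. l t \<in> cotangent_space A (c t)) \<and>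
     (\<forall>(U, u)\<in>A. \<forall>J g e.
        open J \<and> smooth_curve_on J g \<and> g ` J \<subseteq> c -` U \<and> smooth_curve_on J e \<longrightarrow>
        smooth_curve_on J (\<lambda>s. l (g s) (tangent_of A u (c (g s)) (e s))))"

definition smooth_path_alternating ::
    "('m, 'e::convenient_space) atlas \<Rightarrow> (real \<Rightarrow> 'm) \<Rightarrow>
       (real \<Rightarrow> 'm tangent \<Rightarrow> 'm tangent \<Rightarrow> real) \<Rightarrow> bool" where
  "smooth_path_alternating A c b \<longleftrightarrow>
     smooth_path A c \<and> (\<forall>t. b t \<in> alternating_forms A (c t)) \<and>
     (\<forall>(U, u)\<in>A. \<forall>J g e f.
        open J \<and> smooth_curve_on J g \<and> g ` J \<subseteq> c -` U \<and>
        smooth_curve_on J e \<and> smooth_curve_on J f \<longrightarrow>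
        smooth_curve_on J
          (\<lambda>s. b (g s) (tangent_of A u (c (g s)) (e s)) (tangent_of A u (c (g s)) (f s))))"

definition one_form ::
    "('m, 'e::convenient_space) atlas \<Rightarrow> ('m \<Rightarrow> 'm tangent \<Rightarrow> real) \<Rightarrow> bool" where
  "one_form A \<alpha> \<longleftrightarrow>
     (\<forall>p\<in>points A. \<alpha> p \<in> cotangent_space A p) \<and>
     (\<forall>c. smooth_path A c \<longrightarrow> smooth_path_cotangent A c (\<alpha> \<circ> c))"

definition two_form ::
    "('m, 'e::convenient_space) atlas \<Rightarrow>
       ('m \<Rightarrow> 'm tangent \<Rightarrow> 'm tangent \<Rightarrow> real) \<Rightarrow> bool" where
  "two_form A \<omega> \<longleftrightarrow>
     (\<forall>p\<in>points A. \<omega> p \<in> alternating_forms A p) \<and>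
     (\<forall>c. smooth_path A c \<longrightarrow> smooth_path_alternating A c (\<omega> \<circ> c))"

text \<open>
  In a chart \<open>(U, u)\<close>: the derivative at \<open>p\<close>, in direction \<open>v\<close>, of the function obtained by
  evaluating \<open>\<alpha>\<close> on the vector field that is constantly \<open>w\<close>.
\<close>

definition chart_deriv ::
    "('m, 'e::convenient_space) atlas \<Rightarrow> ('m, 'e) chart \<Rightarrow> ('m \<Rightarrow> 'm tangent \<Rightarrow> real) \<Rightarrow>
       'm \<Rightarrow> 'e \<Rightarrow> 'e \<Rightarrow> real" where
  "chart_deriv A k \<alpha> p v w = (case k of (U, u) \<Rightarrow>
     deriv (\<lambda>s. let q = inv_into U u (u p + s *\<^sub>R v) in \<alpha> q (tangent_of A u q w)) 0)"

text \<open>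
  \<open>\<omega> = d\<alpha>\<close>. As for derivatives in the library, this is a relation; it determines \<open>\<omega>\<close> on the
  tangent spaces, and every 1-form has an exterior derivative (KM 33.12).
\<close>

definition has_exterior_derivative ::
    "('m, 'e::convenient_space) atlas \<Rightarrow> ('m \<Rightarrow> 'm tangent \<Rightarrow> real) \<Rightarrow>
       ('m \<Rightarrow> 'm tangent \<Rightarrow> 'm tangent \<Rightarrow> real) \<Rightarrow> bool" where
  "has_exterior_derivative A \<alpha> \<omega> \<longleftrightarrow>
     two_form A \<omega> \<and>
     (\<forall>(U, u)\<in>A. \<forall>p\<in>U. \<forall>v w.
        \<omega> p (tangent_of A u p v) (tangent_of A u p w)
        = chart_deriv A (U, u) \<alpha> p v w - chart_deriv A (U, u) \<alpha> p w v)"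

definition closed_one_form ::
    "('m, 'e::convenient_space) atlas \<Rightarrow> ('m \<Rightarrow> 'm tangent \<Rightarrow> real) \<Rightarrow> bool" where
  "closed_one_form A \<alpha> \<longleftrightarrow> one_form A \<alpha> \<and> has_exterior_derivative A \<alpha> (\<lambda>p X Y. 0)"

section \<open>Distributions\<close>

definition ker_one_form ::
    "('m, 'e::convenient_space) atlas \<Rightarrow> ('m \<Rightarrow> 'm tangent \<Rightarrow> real) \<Rightarrow> 'm \<Rightarrow> 'm tangent set" where
  "ker_one_form A \<alpha> p = {X \<in> tangent_space A p. \<alpha> p X = 0}"

definition ker_two_form ::
    "('m, 'e::convenient_space) atlas \<Rightarrow>
       ('m \<Rightarrow> 'm tangent \<Rightarrow> 'm tangent \<Rightarrow> real) \<Rightarrow> 'm \<Rightarrow> 'm tangent set" where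
  "ker_two_form A \<omega> p = {X \<in> tangent_space A p. \<forall>Y\<in>tangent_space A p. \<omega> p X Y = 0}"

definition distribution ::
    "('m, 'e::convenient_space) atlas \<Rightarrow> ('m \<Rightarrow> 'm tangent set) \<Rightarrow> bool" where
  "distribution A D \<longleftrightarrow> (\<forall>p\<in>points A.
     D p \<subseteq> tangent_space A p \<and> tangent_zero A p \<in> D p \<and>
     (\<forall>X\<in>D p. \<forall>Y\<in>D p. tangent_add A p X Y \<in> D p) \<and>
     (\<forall>X\<in>D p. \<forall>r. tangent_scale A p r X \<in> D p))"

text \<open>
  \<open>\<omega>|D\<close> is degenerate: the map \<open>X \<mapsto> \<omega>(X, \<sqdot>)\<close> from the tangent to the cotangent bundle,
  restricted to the domain \<open>D\<close>, has non-zero kernel at each point. The second argument ranges over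
  the whole tangent space. With it restricted to \<open>D\<close> as well, the degeneracy assumptions of the
  theorem would be too weak: \<open>\<theta> = dt\<close> and \<open>\<eta> = exp t dz\<close> on \<open>\<real>\<^sup>2\<close> would satisfy them, but then
  \<open>d\<eta>\<close> has zero kernel while both 1-forms have no common kernel.
\<close>

definition degenerate_on ::
    "('m, 'e::convenient_space) atlas \<Rightarrow> ('m \<Rightarrow> 'm tangent \<Rightarrow> 'm tangent \<Rightarrow> real) \<Rightarrow>
       ('m \<Rightarrow> 'm tangent set) \<Rightarrow> bool" where
  "degenerate_on A \<omega> D \<longleftrightarrow>
     (\<forall>p\<in>points A. \<exists>X\<in>D p. X \<noteq> tangent_zero A p \<and> (\<forall>Y\<in>tangent_space A p. \<omega> p X Y = 0))"

definition weakly_symplectic_distribution ::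
    "('m, 'e::convenient_space) atlas \<Rightarrow> ('m \<Rightarrow> 'm tangent set) \<Rightarrow>
       ('m \<Rightarrow> 'm tangent \<Rightarrow> 'm tangent \<Rightarrow> real) \<Rightarrow> bool" where
  "weakly_symplectic_distribution A D \<Omega> \<longleftrightarrow>
     distribution A D \<and>
     (\<forall>p\<in>points A.
        (\<forall>X\<in>D p. \<forall>Y\<in>D p. \<Omega> p X Y = - \<Omega> p Y X) \<and>
        (\<forall>X\<in>D p. \<forall>Y\<in>D p. \<forall>Z\<in>D p. \<Omega> p (tangent_add A p X Y) Z = \<Omega> p X Z + \<Omega> p Y Z) \<and>
        (\<forall>X\<in>D p. \<forall>Z\<in>D p. \<forall>r. \<Omega> p (tangent_scale A p r X) Z = r * \<Omega> p X Z) \<and>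
        (\<forall>X\<in>D p. (\<forall>Y\<in>D p. \<Omega> p X Y = 0) \<longrightarrow> X = tangent_zero A p))"

definition tangent_direct_sum ::
    "('m, 'e::convenient_space) atlas \<Rightarrow> ('m \<Rightarrow> 'm tangent set) \<Rightarrow> ('m \<Rightarrow> 'm tangent set) \<Rightarrow>
       ('m \<Rightarrow> 'm tangent set) \<Rightarrow> bool" where
  "tangent_direct_sum A D\<^sub>1 D\<^sub>2 D\<^sub>3 \<longleftrightarrow>
     distribution A D\<^sub>1 \<and> distribution A D\<^sub>2 \<and> distribution A D\<^sub>3 \<and>
     (\<forall>p\<in>points A. \<forall>X\<in>tangent_space A p. \<exists>!(X\<^sub>1, X\<^sub>2, X\<^sub>3).
        X\<^sub>1 \<in> D\<^sub>1 p \<and> X\<^sub>2 \<in> D\<^sub>2 p \<and> X\<^sub>3 \<in> D\<^sub>3 p \<and>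
        X = tangent_add A p (tangent_add A p X\<^sub>1 X\<^sub>2) X\<^sub>3)"

section \<open>Bundle morphisms\<close>

text \<open>Bundle morphisms from the tangent to the cotangent bundle over the identity.\<close>

definition cotangent_bundle_morphism ::
    "('m, 'e::convenient_space) atlas \<Rightarrow>
       ('m \<Rightarrow> 'm tangent \<Rightarrow> 'm tangent \<Rightarrow> real) \<Rightarrow> bool" where
  "cotangent_bundle_morphism A F \<longleftrightarrow>
     (\<forall>p\<in>points A. \<forall>X\<in>tangent_space A p.
        F p X \<in> cotangent_space A p \<and>
        (\<forall>Y\<in>tangent_space A p. \<forall>Z\<in>tangent_space A p.
           F p (tangent_add A p X Y) Z = F p X Z + F p Y Z) \<and>
        (\<forall>Z\<in>tangent_space A p. \<forall>r. F p (tangent_scale A p r X) Z = r * F p X Z)) \<and>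
     (\<forall>c X. smooth_path_tangent A c X \<longrightarrow> smooth_path_cotangent A c (\<lambda>t. F (c t) (X t)))"

definition injective_bundle_morphism ::
    "('m, 'e::convenient_space) atlas \<Rightarrow>
       ('m \<Rightarrow> 'm tangent \<Rightarrow> 'm tangent \<Rightarrow> real) \<Rightarrow> bool" where
  "injective_bundle_morphism A F \<longleftrightarrow>
     cotangent_bundle_morphism A F \<and>
     (\<forall>p\<in>points A. \<forall>X\<in>tangent_space A p. \<forall>Y\<in>tangent_space A p.
        (\<forall>Z\<in>tangent_space A p. F p X Z = F p Y Z) \<longrightarrow> X = Y)"

definition flat ::
    "('m \<Rightarrow> 'm tangent \<Rightarrow> real) \<Rightarrow> ('m \<Rightarrow> 'm tangent \<Rightarrow> real) \<Rightarrow>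
       ('m \<Rightarrow> 'm tangent \<Rightarrow> 'm tangent \<Rightarrow> real) \<Rightarrow> 'm \<Rightarrow> 'm tangent \<Rightarrow> 'm tangent \<Rightarrow> real" where
  "flat \<theta> \<eta> d\<eta> p X Y = \<theta> p X * \<theta> p Y + d\<eta> p X Y + \<eta> p X * \<eta> p Y"

end

theory Submission
  imports Defs
begin

text \<open>
  All three conditions are equivalent to the vanishing of \<open>ker \<theta> \<inter> ker \<eta> \<inter> ker d\<eta>\<close> at every point.
  For the map \<open>\<flat>\<close>, pairing \<open>\<flat> v\<close> with \<open>v\<close> gives \<open>\<theta>(v)\<^sup>2 + \<eta>(v)\<^sup>2\<close>, so its kernel is this intersection.
  For the other two, degeneracy provides \<open>R\<close> and \<open>S\<close> in \<open>ker d\<eta>\<close> with \<open>\<theta>(R) = 0 \<noteq> \<eta>(R)\<close> and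
  \<open>\<eta>(S) = 0 \<noteq> \<theta>(S)\<close>, and these span a complement of \<open>ker \<theta> \<inter> ker \<eta>\<close>.
\<close>

section \<open>Smooth curves\<close>

text \<open>Scalar-valued curves are thereby covered by the rules for locally convex spaces; the
  product of two real curves becomes a case of scalar multiplication.\<close>

instance real :: locally_convex_space
proof
  show "((\<lambda>(r, x). r *\<^sub>R x) \<longlongrightarrow> a *\<^sub>R y) (nhds a \<times>\<^sub>F nhds y)" for a y :: real
    unfolding case_prod_beta by (intro tendsto_scaleR filterlim_fst filterlim_snd)
  fix U :: "real set" assume "open U" "0 \<in> U"
  then obtain \<epsilon> where \<epsilon>: "\<epsilon> > 0" "ball 0 \<epsilon> \<subseteq> U"
    by (meson open_contains_ball)
  show "\<exists>V. open V \<and> 0 \<in> V \<and> V \<subseteq> U \<and>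
      (\<forall>x\<in>V. \<forall>y\<in>V. \<forall>r\<ge>0. \<forall>s\<ge>0. r + s = 1 \<longrightarrow> r *\<^sub>R x + s *\<^sub>R y \<in> V)"
    using \<epsilon> convex_ball[of "0::real" \<epsilon>] unfolding convex_def
    by (intro exI[of _ "ball 0 \<epsilon>"]) auto
qed

section \<open>Rules for derivatives of curves\<close>

lemma tendsto_scaleR_locally_convex:
  fixes g :: "'b \<Rightarrow> 'a::locally_convex_space"
  assumes "(f \<longlongrightarrow> a) F" "(g \<longlongrightarrow> y) F"
  shows "((\<lambda>x. f x *\<^sub>R g x) \<longlongrightarrow> a *\<^sub>R y) F"
  using filterlim_compose[OF tendsto_scaleR_lcs filterlim_Pair[OF assms]] by simp

lemma has_curve_derivative_real_iff:
  "has_curve_derivative c e t \<longleftrightarrow> (c has_real_derivative e) (at t)"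
  by (simp add: has_curve_derivative_def DERIV_def divide_inverse mult.commute)

lemma has_curve_derivative_unique:
  assumes "has_curve_derivative c d t" "has_curve_derivative c e t"
  shows "d = e"
  using assms tendsto_unique[of "at (0::real)"] unfolding has_curve_derivative_def by auto

lemma velocity_eqI: "has_curve_derivative c e t \<Longrightarrow> velocity c t = e"
  unfolding velocity_def by (blast intro: has_curve_derivative_unique)

lemma has_curve_derivative_add:
  assumes "has_curve_derivative c d t" "has_curve_derivative c' d' t"
  shows "has_curve_derivative (\<lambda>s. c s + c' s) (d + d') t"
  using tendsto_add[OF assms[unfolded has_curve_derivative_def]]
  by (simp add: has_curve_derivative_def algebra_simps)

text \<open>The increment splits as \<open>(a (t + h) - a t) *\<^sub>R c t + a (t + h) *\<^sub>R (c
  (t + h) - c t)\<close>. The only shifted factor outside a difference is \<open>a (t + h)\<close>,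
  which converges because \<open>a\<close> is differentiable.\<close>

lemma has_curve_derivative_scaleR:
  fixes c :: "real \<Rightarrow> 'a::locally_convex_space"
  assumes "has_curve_derivative a a' t" "has_curve_derivative c c' t"
  shows "has_curve_derivative (\<lambda>s. a s *\<^sub>R c s) (a' *\<^sub>R c t + a t *\<^sub>R c') t"
proof -
  have "isCont a t"
    using assms(1) by (auto simp: has_curve_derivative_real_iff intro: DERIV_isCont)
  hence "((\<lambda>h. a (t + h)) \<longlongrightarrow> a t) (at 0)"
    by (simp add: isCont_def LIM_offset_zero_iff)
  from tendsto_scaleR_locally_convex[OF this assms(2)[unfolded has_curve_derivative_def]]
  have "((\<lambda>h. a (t + h) *\<^sub>R (1 / h) *\<^sub>R (c (t + h) - c t)) \<longlongrightarrow> a t *\<^sub>R c') (at 0)" .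
  moreover have "((\<lambda>h. ((1 / h) *\<^sub>R (a (t + h) - a t)) *\<^sub>R c t) \<longlongrightarrow> a' *\<^sub>R c t) (at 0)"
    using assms(1) by (intro tendsto_scaleR_locally_convex) (auto simp: has_curve_derivative_def)
  ultimately have "((\<lambda>h. ((1 / h) *\<^sub>R (a (t + h) - a t)) *\<^sub>R c t +
      a (t + h) *\<^sub>R (1 / h) *\<^sub>R (c (t + h) - c t)) \<longlongrightarrow> a' *\<^sub>R c t + a t *\<^sub>R c') (at 0)"
    by (intro tendsto_add)
  thus ?thesis
    by (simp add: has_curve_derivative_def algebra_simps diff_divide_distrib)
qed

lemma has_curve_derivative_compose:
  fixes f :: "real \<Rightarrow> 'a::locally_convex_space"
  assumes "has_curve_derivative g g' t" "has_curve_derivative f f' (g t)"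
  shows "has_curve_derivative (\<lambda>s. f (g s)) (g' *\<^sub>R f') t"
proof -
  \<comment> \<open>\<open>\<phi>\<close> is the difference quotient of \<open>f\<close> at
    \<open>g t\<close>, filled in at \<open>0\<close> by the derivative. Being continuous there, it
    may be composed with the increment of \<open>g\<close>, which can vanish for
    \<open>h \<noteq> 0\<close>.\<close>
  define \<phi> where "\<phi> k = (if k = 0 then f' else (1 / k) *\<^sub>R (f (g t + k) - f (g t)))" for k
  have "(\<phi> \<longlongrightarrow> f') (at 0)"
    using assms(2) unfolding has_curve_derivative_def
    by (rule Lim_transform_eventually) (auto simp: \<phi>_def eventually_at_filter)
  moreover have "\<phi> 0 = f'" by (simp add: \<phi>_def)
  ultimately have *: "(\<phi> \<longlongrightarrow> f') (nhds 0)"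
    using tendsto_at_iff_tendsto_nhds[of \<phi> 0] by simp
  have "isCont g t"
    using assms(1) by (auto simp: has_curve_derivative_real_iff intro: DERIV_isCont)
  hence "((\<lambda>h. g (t + h) - g t) \<longlongrightarrow> 0) (at 0)"
    by (simp add: isCont_def LIM_offset_zero_iff LIM_zero_iff)
  from filterlim_compose[OF * this] assms(1)
  have "((\<lambda>h. ((1 / h) *\<^sub>R (g (t + h) - g t)) *\<^sub>R \<phi> (g (t + h) - g t)) \<longlongrightarrow> g' *\<^sub>R f') (at 0)"
    unfolding has_curve_derivative_def by (rule tendsto_scaleR_locally_convex[rotated])
  \<comment> \<open>Where the increment of \<open>g\<close> vanishes, both sides are
    \<open>0\<close>.\<close>
  moreover have "((1 / h) *\<^sub>R (g (t + h) - g t)) *\<^sub>R \<phi> (g (t + h) - g t) =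
      (1 / h) *\<^sub>R (f (g (t + h)) - f (g t))" for h
    by (simp add: \<phi>_def)
  ultimately show ?thesis
    by (simp add: has_curve_derivative_def)
qed

lemma has_curve_derivative_cong_open:
  assumes "open I" "t \<in> I" "\<And>s. s \<in> I \<Longrightarrow> c s = d s" "has_curve_derivative c e t"
  shows "has_curve_derivative d e t"
proof -
  have "((\<lambda>h. t + h) \<longlongrightarrow> t + 0) (at 0)"
    by (intro tendsto_intros)
  hence "\<forall>\<^sub>F h in at 0. t + h \<in> I"
    using assms(1,2) by (auto dest: topological_tendstoD)
  hence "\<forall>\<^sub>F h in at 0. (1 / h) *\<^sub>R (c (t + h) - c t) = (1 / h) *\<^sub>R (d (t + h) - d t)"
    by eventually_elim (use assms(2,3) in simp)
  with assms(4) show ?thesis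
    unfolding has_curve_derivative_def by (rule Lim_transform_eventually)
qed

lemma has_curve_derivative_affine:
  fixes x y :: "'a::real_vector_t2"
  shows "has_curve_derivative (\<lambda>s. x + s *\<^sub>R y) y t"
  unfolding has_curve_derivative_def
  by (rule Lim_transform_eventually[OF tendsto_const])
    (auto simp: eventually_at_filter algebra_simps)

section \<open>Smoothness by coinduction, and closure under sums, products and composition\<close>

lemma smooth_curve_on_coinduct:
  assumes "P c"
    and step: "\<And>c. P c \<Longrightarrow> \<exists>d. P d \<and> (\<forall>t\<in>I. has_curve_derivative c (d t) t)"
  shows "smooth_curve_on I c"
proof -
  \<comment> \<open>Dependent choice strings single derivatives together: \<open>D (Suc n)\<close>
    is a derivative of \<open>D n\<close> that again satisfies \<open>P\<close>, so the next choice
    is possible.\<close>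
  have "\<exists>D. \<forall>n. (P (D n) \<and> (n = 0 \<longrightarrow> D n = c)) \<and>
      (\<forall>t\<in>I. has_curve_derivative (D n) (D (Suc n) t) t)"
    by (rule dependent_nat_choice) (use assms in auto)
  thus ?thesis unfolding smooth_curve_on_def by blast
qed

lemma smooth_curve_on_derivative:
  assumes "smooth_curve_on I c"
  obtains d where "smooth_curve_on I d" "\<forall>t\<in>I. has_curve_derivative c (d t) t"
proof -
  from assms obtain D where
    D: "D 0 = c" "\<forall>n. \<forall>t\<in>I. has_curve_derivative (D n) (D (Suc n) t) t"
    unfolding smooth_curve_on_def by blast
  have "smooth_curve_on I (D 1)"
    unfolding smooth_curve_on_def using D(2) by (intro exI[of _ "\<lambda>n. D (Suc n)"]) simp
  thus ?thesis using that D by auto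
qed

lemma smooth_curve_on_subset: "smooth_curve_on I c \<Longrightarrow> J \<subseteq> I \<Longrightarrow> smooth_curve_on J c"
  unfolding smooth_curve_on_def by blast

lemma smooth_curve_on_cong:
  assumes "open I" "\<And>s. s \<in> I \<Longrightarrow> c s = d s" "smooth_curve_on I c"
  shows "smooth_curve_on I d"
proof -
  obtain D where D: "D 0 = c" "\<forall>n. \<forall>t\<in>I. has_curve_derivative (D n) (D (Suc n) t) t"
    using assms(3) unfolding smooth_curve_on_def by blast
  moreover have "has_curve_derivative d (D 1 t) t" if "t \<in> I" for t
    using has_curve_derivative_cong_open[OF assms(1) that, of c d] assms(2) that D by force
  \<comment> \<open>On the open set \<open>I\<close> both curves have the derivative
    \<open>D 1\<close>, so only the zeroth entry of the sequence changes.\<close>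
  ultimately show ?thesis
    unfolding smooth_curve_on_def
    by (intro exI[of _ "D(0 := d)"]) auto
qed

inductive_set curve_sums :: "(real \<Rightarrow> 'a::real_vector_t2) set \<Rightarrow> (real \<Rightarrow> 'a) set" for B where
  base: "c \<in> B \<Longrightarrow> c \<in> curve_sums B"
| add: "c \<in> curve_sums B \<Longrightarrow> d \<in> curve_sums B \<Longrightarrow> (\<lambda>s. c s + d s) \<in> curve_sums B"

text \<open>
  Coinduction up to sums: it absorbs the Leibniz and chain rules, which turn one term into a sum
  of terms of the same shape.
\<close>

lemma smooth_curve_on_sums:
  assumes "c \<in> curve_sums B"
    and "\<And>c. c \<in> B \<Longrightarrow> \<exists>d\<in>curve_sums B. \<forall>t\<in>I. has_curve_derivative c (d t) t"
  shows "smooth_curve_on I c"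
proof (rule smooth_curve_on_coinduct)
  show "\<exists>d. d \<in> curve_sums B \<and> (\<forall>t\<in>I. has_curve_derivative c (d t) t)" if "c \<in> curve_sums B" for c
    using that
  proof induction
    case (base c)
    thus ?case using assms(2) by blast
  next
    case (add c d)
    then obtain c' d' where "c' \<in> curve_sums B" "\<forall>t\<in>I. has_curve_derivative c (c' t) t"
      "d' \<in> curve_sums B" "\<forall>t\<in>I. has_curve_derivative d (d' t) t" by blast
    thus ?case
      by (intro exI[of _ "\<lambda>s. c' s + d' s"])
        (auto intro: curve_sums.add has_curve_derivative_add)
  qed
qed (fact assms(1))

lemma smooth_curve_on_add:
  assumes "smooth_curve_on I c" "smooth_curve_on I d"
  shows "smooth_curve_on I (\<lambda>s. c s + d s)"
proof (rule smooth_curve_on_sums)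
  show "(\<lambda>s. c s + d s) \<in> curve_sums (Collect (smooth_curve_on I))"
    using assms by (simp add: curve_sums.add curve_sums.base)
  show "\<exists>d\<in>curve_sums (Collect (smooth_curve_on I)). \<forall>t\<in>I. has_curve_derivative c (d t) t"
    if "c \<in> Collect (smooth_curve_on I)" for c :: "real \<Rightarrow> 'a"
  proof -
    from that have "smooth_curve_on I c" by simp
    then obtain d where "smooth_curve_on I d" "\<forall>t\<in>I. has_curve_derivative c (d t) t"
      by (rule smooth_curve_on_derivative)
    thus ?thesis by (blast intro: curve_sums.base)
  qed
qed

lemma smooth_curve_on_scaleR:
  fixes c :: "real \<Rightarrow> 'a::locally_convex_space"
  assumes "smooth_curve_on I a" "smooth_curve_on I c"
  shows "smooth_curve_on I (\<lambda>s. a s *\<^sub>R c s)"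
proof (rule smooth_curve_on_sums)
  let ?B = "{\<lambda>s. a s *\<^sub>R c s |a (c :: real \<Rightarrow> 'a). smooth_curve_on I a \<and> smooth_curve_on I c}"
  show "(\<lambda>s. a s *\<^sub>R c s) \<in> curve_sums ?B"
    using assms by (blast intro: curve_sums.base)
  fix k :: "real \<Rightarrow> 'a" assume "k \<in> ?B"
  then obtain a c where k: "k = (\<lambda>s. a s *\<^sub>R c s)" "smooth_curve_on I a" "smooth_curve_on I c"
    by blast
  obtain a' where a': "smooth_curve_on I a'" "\<forall>t\<in>I. has_curve_derivative a (a' t) t"
    using k(2) by (rule smooth_curve_on_derivative)
  obtain c' where c': "smooth_curve_on I c'" "\<forall>t\<in>I. has_curve_derivative c (c' t) t"
    using k(3) by (rule smooth_curve_on_derivative)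
  have "(\<lambda>s. a' s *\<^sub>R c s + a s *\<^sub>R c' s) \<in> curve_sums ?B"
    using k a' c' by (intro curve_sums.add curve_sums.base) blast+
  moreover have "\<forall>t\<in>I. has_curve_derivative k (a' t *\<^sub>R c t + a t *\<^sub>R c' t) t"
    using a' c' by (auto simp: k(1) intro: has_curve_derivative_scaleR)
  ultimately show "\<exists>d\<in>curve_sums ?B. \<forall>t\<in>I. has_curve_derivative k (d t) t"
    by (intro bexI[of _ "\<lambda>s. a' s *\<^sub>R c s + a s *\<^sub>R c' s"])
qed

lemma smooth_curve_on_mult:
  fixes a b :: "real \<Rightarrow> real"
  assumes "smooth_curve_on I a" "smooth_curve_on I b"
  shows "smooth_curve_on I (\<lambda>s. a s * b s)"
  using smooth_curve_on_scaleR[OF assms] by simp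

lemma smooth_curve_on_affine: "smooth_curve_on I (\<lambda>s. x + s *\<^sub>R y)"
proof (rule smooth_curve_on_coinduct)
  show "\<exists>x' y'. (\<lambda>s. x + s *\<^sub>R y) = (\<lambda>s. x' + s *\<^sub>R y')" by blast
  fix c :: "real \<Rightarrow> 'a" assume "\<exists>x' y'. c = (\<lambda>s. x' + s *\<^sub>R y')"
  then obtain x' y' where c: "c = (\<lambda>s. x' + s *\<^sub>R y')" by blast
  have "(\<lambda>s. y') = (\<lambda>s. y' + s *\<^sub>R 0)" by simp
  thus "\<exists>d. (\<exists>x' y'. d = (\<lambda>s. x' + s *\<^sub>R y')) \<and> (\<forall>t\<in>I. has_curve_derivative c (d t) t)"
    unfolding c by (intro exI[of _ "\<lambda>s. y'"] conjI ballI has_curve_derivative_affine) blast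
qed

lemma smooth_curve_on_compose:
  fixes f :: "real \<Rightarrow> 'a::locally_convex_space"
  assumes "smooth_curve_on J g" "smooth_curve_on I f" "g ` J \<subseteq> I"
  shows "smooth_curve_on J (\<lambda>s. f (g s))"
proof (rule smooth_curve_on_sums)
  \<comment> \<open>The factor \<open>h\<close> makes the family stable: differentiating
    \<open>h s *\<^sub>R f (g s)\<close> gives one term with \<open>h'\<close> and \<open>f\<close>
    and one with \<open>h * g'\<close> and \<open>f'\<close>. The composition itself is the case of
    the constant factor \<open>1\<close>.\<close>
  let ?B = "{\<lambda>s. h s *\<^sub>R f (g s) |h (f :: real \<Rightarrow> 'a). smooth_curve_on J h \<and> smooth_curve_on I f}"
  have in_B: "(\<lambda>s. h s *\<^sub>R f (g s)) \<in> ?B" if "smooth_curve_on J h" "smooth_curve_on I f" for h f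
    using that by (intro CollectI exI[of _ h] exI[of _ f]) simp
  have "smooth_curve_on J (\<lambda>s. 1 :: real)"
    using smooth_curve_on_affine[of J "1::real" 0] by simp
  from curve_sums.base[OF in_B[OF this assms(2)]]
  show "(\<lambda>s. f (g s)) \<in> curve_sums ?B" by simp
  fix k :: "real \<Rightarrow> 'a" assume "k \<in> ?B"
  then obtain h f where k: "k = (\<lambda>s. h s *\<^sub>R f (g s))" "smooth_curve_on J h" "smooth_curve_on I f"
    by blast
  obtain g' where g': "smooth_curve_on J g'" "\<forall>t\<in>J. has_curve_derivative g (g' t) t"
    using assms(1) by (rule smooth_curve_on_derivative)
  obtain h' where h': "smooth_curve_on J h'" "\<forall>t\<in>J. has_curve_derivative h (h' t) t"
    using k(2) by (rule smooth_curve_on_derivative)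
  obtain f' where f': "smooth_curve_on I f'" "\<forall>t\<in>I. has_curve_derivative f (f' t) t"
    using k(3) by (rule smooth_curve_on_derivative)
  have "smooth_curve_on J (\<lambda>s. h s * g' s)"
    using k(2) g'(1) by (rule smooth_curve_on_mult)
  hence "(\<lambda>s. h' s *\<^sub>R f (g s) + (h s * g' s) *\<^sub>R f' (g s)) \<in> curve_sums ?B"
    using in_B[OF h'(1) k(3)] in_B[OF _ f'(1)] by (intro curve_sums.add curve_sums.base)
  moreover have "\<forall>t\<in>J. has_curve_derivative k (h' t *\<^sub>R f (g t) + (h t * g' t) *\<^sub>R f' (g t)) t"
  proof
    fix t assume "t \<in> J"
    hence "has_curve_derivative (\<lambda>s. f (g s)) (g' t *\<^sub>R f' (g t)) t"
      using g' f' assms(3) by (intro has_curve_derivative_compose) auto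
    from has_curve_derivative_scaleR[OF bspec[OF h'(2) \<open>t \<in> J\<close>] this]
    show "has_curve_derivative k (h' t *\<^sub>R f (g t) + (h t * g' t) *\<^sub>R f' (g t)) t"
      by (simp add: k(1))
  qed
  ultimately show "\<exists>d\<in>curve_sums ?B. \<forall>t\<in>J. has_curve_derivative k (d t) t"
    by (intro bexI[of _ "\<lambda>s. h' s *\<^sub>R f (g s) + (h s * g' s) *\<^sub>R f' (g s)"])
qed

text \<open>The span of \<open>sin (t / r)\<close> and \<open>cos (t / r)\<close> is closed under
  differentiation and so serves as the coinduction invariant.\<close>

lemma smooth_curve_on_sin_cos:
  fixes a b r :: real
  assumes "r \<noteq> 0"
  shows "smooth_curve_on I (\<lambda>t. a * sin (t / r) + b * cos (t / r))"
proof (rule smooth_curve_on_coinduct)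
  let ?P = "\<lambda>c. \<exists>a b. c = (\<lambda>t. a * sin (t / r) + b * cos (t / r))"
  show "?P (\<lambda>t. a * sin (t / r) + b * cos (t / r))" by blast
  fix c assume "?P c"
  then obtain a b where c: "c = (\<lambda>t. a * sin (t / r) + b * cos (t / r))" by blast
  have "(c has_real_derivative (- b / r) * sin (t / r) + (a / r) * cos (t / r)) (at t)" for t
    unfolding c by (auto intro!: derivative_eq_intros simp: assms mult.commute)
  thus "\<exists>d. ?P d \<and> (\<forall>t\<in>I. has_curve_derivative c (d t) t)"
    unfolding has_curve_derivative_real_iff
    by (intro exI[of _ "\<lambda>t. (- b / r) * sin (t / r) + (a / r) * cos (t / r)"] conjI ballI) blast+
qed

section \<open>Tangent spaces\<close>

lemma chart_at:
  assumes "p \<in> points A"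
  obtains U u where "chart_at A p = (U, u)" "(U, u) \<in> A" "p \<in> U"
proof -
  have "\<exists>k. k \<in> A \<and> p \<in> fst k" using assms by (force simp: points_def)
  hence "chart_at A p \<in> A \<and> p \<in> fst (chart_at A p)" unfolding chart_at_def by (rule someI_ex)
  thus ?thesis using that by (cases "chart_at A p") auto
qed

text \<open>
  A smooth path is defined on all of \<open>\<real>\<close>, while the straight line in direction \<open>e\<close> may leave the
  chart; it is therefore traversed as \<open>t \<mapsto> r sin (t / r)\<close> for a small \<open>r\<close>.
\<close>

lemma tangent_of_nonempty:
  fixes A :: "('m, 'e::convenient_space) atlas"
  assumes A: "convenient_manifold A" and U: "(U, u) \<in> A" "p \<in> U"
  shows "tangent_of A u p e \<noteq> {}"
proof -
  have inj: "inj_on u U" and op: "cinf_open (u ` U)"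
    using A U(1) by (auto simp: convenient_manifold_def)
  let ?l = "\<lambda>s. u p + s *\<^sub>R e"
  \<comment> \<open>The definition of \<open>cinf_open\<close>, applied to the straight line, gives
    an interval of parameters about \<open>0\<close> that stay in the chart image.\<close>
  have "open (?l -` (u ` U))"
    using op smooth_curve_on_affine unfolding cinf_open_def by blast
  moreover have "0 \<in> ?l -` (u ` U)" using U(2) by simp
  ultimately obtain \<epsilon> where "\<epsilon> > 0" "ball 0 \<epsilon> \<subseteq> ?l -` (u ` U)"
    by (meson open_contains_ball)
  hence \<epsilon>: "\<epsilon> > 0" "\<And>s. \<bar>s\<bar> < \<epsilon> \<Longrightarrow> ?l s \<in> u ` U" by auto
  \<comment> \<open>Halving leaves room for the non-strict bound
    \<open>\<bar>g t\<bar> \<le> r\<close>. Since \<open>g\<close> has derivative \<open>1\<close>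
    at \<open>0\<close>, the reparametrised line keeps the velocity \<open>e\<close>.\<close>
  define r where "r = \<epsilon> / 2"
  have r: "r > 0" "r < \<epsilon>" using \<epsilon>(1) by (auto simp: r_def)
  define g where "g t = r * sin (t / r)" for t
  define \<gamma> where "\<gamma> t = ?l (g t)" for t
  have "smooth_curve_on UNIV g"
    using smooth_curve_on_sin_cos[of r UNIV r 0] r by (simp add: g_def[abs_def])
  hence \<gamma>_smooth: "smooth_curve_on UNIV \<gamma>"
    unfolding \<gamma>_def[abs_def]
    by (rule smooth_curve_on_compose[OF _ smooth_curve_on_affine[of UNIV]]) simp
  have "has_curve_derivative g 1 0"
    unfolding has_curve_derivative_real_iff g_def[abs_def]
    using r by (auto intro!: derivative_eq_intros)
  hence \<gamma>_velocity: "velocity \<gamma> 0 = e"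
    using has_curve_derivative_compose[OF _ has_curve_derivative_affine, of g 1 0 "u p" e]
    by (auto simp: \<gamma>_def[abs_def] intro: velocity_eqI)
  have "\<bar>g t\<bar> \<le> r" for t
    using r mult_left_mono[OF abs_sin_le_one[of "t / r"], of r] by (simp add: g_def abs_mult)
  hence \<gamma>_U: "\<gamma> t \<in> u ` U" for t
    using \<epsilon>(2) r unfolding \<gamma>_def by (meson le_less_trans)
  define c where "c t = inv_into U u (\<gamma> t)" for t
  have c_U: "c t \<in> U" and u_c: "u (c t) = \<gamma> t" for t
    unfolding c_def by (rule inv_into_into[OF \<gamma>_U], rule f_inv_into_f[OF \<gamma>_U])
  have "c 0 = p"
    using inj U(2) by (simp add: c_def \<gamma>_def g_def)
  moreover have "smooth_path A c"
    unfolding smooth_path_def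
  proof (intro conjI ballI, goal_cases)
    case 1
    show ?case using c_U U(1) by (force simp: points_def)
  next
    case (2 k)
    obtain V v where k: "k = (V, v)" by (cases k)
    have V: "cinf_open (u ` (U \<inter> V))" "smooth_map_on (u ` (U \<inter> V)) (v \<circ> inv_into U u)"
      using A U(1) 2 unfolding k convenient_manifold_def by blast+
    \<comment> \<open>Smoothness of \<open>c\<close> in another chart is checked in the model space:
      \<open>c\<close> lies in \<open>V\<close> exactly when \<open>\<gamma>\<close> lies in the
      domain of the transition map, which is c-infinity-open.\<close>
    have eq: "c -` V = \<gamma> -` (u ` (U \<inter> V))"
    proof (intro equalityI subsetI)
      fix t assume "t \<in> c -` V"
      thus "t \<in> \<gamma> -` (u ` (U \<inter> V))" using c_U[of t] u_c[of t] by (auto intro!: image_eqI[of _ _ "c t"])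
    next
      fix t assume "t \<in> \<gamma> -` (u ` (U \<inter> V))"
      then obtain q where "q \<in> U" "q \<in> V" "\<gamma> t = u q" by auto
      thus "t \<in> c -` V" using inj by (simp add: c_def)
    qed
    have "open (c -` V)"
      using V(1) \<gamma>_smooth unfolding eq cinf_open_def by blast
    moreover have "smooth_curve_on (c -` V) (v \<circ> inv_into U u \<circ> \<gamma>)"
      using V(2) \<open>open (c -` V)\<close> smooth_curve_on_subset[OF \<gamma>_smooth, of "c -` V"]
      unfolding smooth_map_on_def by (auto simp: eq)
    moreover have "v \<circ> inv_into U u \<circ> \<gamma> = v \<circ> c" by (auto simp: c_def)
    ultimately show ?case by (simp add: k)
  qed
  moreover have "u \<circ> c = \<gamma>" using u_c by auto
  ultimately have "c \<in> tangent_of A u p e"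
    using \<gamma>_velocity by (simp add: tangent_of_def paths_at_def)
  thus ?thesis by blast
qed

text \<open>Nonemptiness makes the representative chosen by \<open>SOME\<close> a member of the
  class, and all members have velocity \<open>e\<close>. In particular
  \<open>tangent_of A u p\<close> is injective.\<close>

lemma tangent_coord_of:
  assumes "convenient_manifold A" "(U, u) \<in> A" "p \<in> U"
  shows "tangent_coord u (tangent_of A u p e) = e"
proof -
  have "(SOME c. c \<in> tangent_of A u p e) \<in> tangent_of A u p e"
    using tangent_of_nonempty[OF assms] by (simp add: some_in_eq)
  thus ?thesis by (auto simp: tangent_coord_def tangent_of_def)
qed

lemma tangent_space_eq_range:
  assumes "convenient_manifold A" "p \<in> points A"
  shows "tangent_space A p = range (tangent_of A (snd (chart_at A p)) p)"
proof -
  obtain U u where k: "chart_at A p = (U, u)" "(U, u) \<in> A" "p \<in> U"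
    using assms(2) by (rule chart_at)
  \<comment> \<open>An equivalence class is a fibre of the velocity map in the selected chart, so
    the quotient is indexed by the attained velocities; by \<open>tangent_of_nonempty\<close> these
    fill the model space.\<close>
  have class_eq: "tangent_rel A p `` {c} = tangent_of A u p (velocity (u \<circ> c) 0)"
    if "c \<in> paths_at A p" for c
    using that by (auto simp: tangent_rel_def tangent_of_def k(1))
  have "tangent_of A u p e \<in> tangent_space A p" for e
  proof -
    obtain c where "c \<in> tangent_of A u p e"
      using tangent_of_nonempty[OF assms(1) k(2,3)] by blast
    hence "c \<in> paths_at A p" "velocity (u \<circ> c) 0 = e" by (auto simp: tangent_of_def)
    thus ?thesis using class_eq[of c] by (auto simp: tangent_space_def intro!: quotientI dest: sym)
  qed
  moreover have "X \<in> range (tangent_of A u p)" if "X \<in> tangent_space A p" for X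
    using that class_eq by (auto simp: tangent_space_def elim!: quotientE)
  ultimately show ?thesis by (auto simp: k(1))
qed

text \<open>The selected chart is also the one in which \<open>tangent_add\<close> and
  \<open>tangent_scale\<close> are defined, so at a point of a convenient manifold this is a linear
  isomorphism onto the tangent space. It moves fibrewise questions to the model space.\<close>

definition tangent_iso :: "('m, 'e::convenient_space) atlas \<Rightarrow> 'm \<Rightarrow> 'e \<Rightarrow> 'm tangent" where
  "tangent_iso A p = tangent_of A (snd (chart_at A p)) p"

lemma
  assumes "convenient_manifold A" "p \<in> points A"
  shows tangent_space_eq: "tangent_space A p = range (tangent_iso A p)"
    and inj_tangent_iso: "inj (tangent_iso A p)"
    and tangent_zero_eq: "tangent_zero A p = tangent_iso A p 0"
    and tangent_add_iso:
      "tangent_add A p (tangent_iso A p x) (tangent_iso A p y) = tangent_iso A p (x + y)"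
    and tangent_scale_iso: "tangent_scale A p r (tangent_iso A p x) = tangent_iso A p (r *\<^sub>R x)"
proof -
  obtain U u where k: "chart_at A p = (U, u)" "(U, u) \<in> A" "p \<in> U"
    using assms(2) by (rule chart_at)
  note coord = tangent_coord_of[OF assms(1) k(2,3)]
  show "tangent_space A p = range (tangent_iso A p)"
    using tangent_space_eq_range[OF assms] by (simp add: tangent_iso_def)
  show "inj (tangent_iso A p)"
    by (rule inj_on_inverseI[of _ "tangent_coord u"]) (simp add: tangent_iso_def k(1) coord)
  show "tangent_zero A p = tangent_iso A p 0"
    by (simp add: tangent_iso_def tangent_zero_def)
  show "tangent_add A p (tangent_iso A p x) (tangent_iso A p y) = tangent_iso A p (x + y)"
    by (simp add: tangent_iso_def tangent_add_def k(1) coord)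
  show "tangent_scale A p r (tangent_iso A p x) = tangent_iso A p (r *\<^sub>R x)"
    by (simp add: tangent_iso_def tangent_scale_def k(1) coord)
qed

section \<open>Distributions, covectors and the map \<open>flat\<close> in chart coordinates\<close>

lemma distributionI:
  assumes "convenient_manifold A"
    and "\<And>p. p \<in> points A \<Longrightarrow> subspace (S p)"
    and "\<And>p. p \<in> points A \<Longrightarrow> D p = tangent_iso A p ` S p"
  shows "distribution A D"
  unfolding distribution_def
proof (intro ballI conjI allI)
  fix p assume p: "p \<in> points A"
  note S = assms(2)[OF p] assms(3)[OF p]
  note iso = tangent_space_eq[OF assms(1) p] tangent_zero_eq[OF assms(1) p]
    tangent_add_iso[OF assms(1) p] tangent_scale_iso[OF assms(1) p]
  show "D p \<subseteq> tangent_space A p" "tangent_zero A p \<in> D p"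
    using S by (auto simp: iso subspace_0)
  show "tangent_add A p X Y \<in> D p" if "X \<in> D p" "Y \<in> D p" for X Y
    using that S by (auto simp: iso subspace_add)
  show "tangent_scale A p r X \<in> D p" if "X \<in> D p" for X r
    using that S by (auto simp: iso subspace_scale)
qed

lemma cotangent_space_linear:
  assumes "p \<in> points A" "l \<in> cotangent_space A p"
  shows "linear (\<lambda>x. l (tangent_iso A p x))"
proof -
  obtain U u where "chart_at A p = (U, u)" "(U, u) \<in> A" "p \<in> U"
    using assms(1) by (rule chart_at)
  thus ?thesis
    using assms(2) by (auto simp: cotangent_space_def continuous_dual_def tangent_iso_def)
qed

lemma cotangent_space_add:
  assumes "l \<in> cotangent_space A p" "m \<in> cotangent_space A p"
  shows "(\<lambda>X. l X + m X) \<in> cotangent_space A p"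
  using assms unfolding cotangent_space_def continuous_dual_def
  by (auto intro!: continuous_map_add linear_compose_add dest!: bspec)

lemma cotangent_space_scale:
  assumes "l \<in> cotangent_space A p"
  shows "(\<lambda>X. r * l X) \<in> cotangent_space A p"
  using assms linear_compose_scale_right[where c = r]
  unfolding cotangent_space_def continuous_dual_def
  by (fastforce intro!: continuous_map_real_mult_left)

text \<open>In a fibre the value at \<open>X\<close> is a linear combination of the covectors
  \<open>\<theta> p\<close>, \<open>\<eta> p\<close> and \<open>\<omega> p X\<close>. Along a smooth
  path, the chart expression is built by sums and products from functions that are smooth because
  the three forms are.\<close>

lemma cotangent_bundle_morphism_flat:
  fixes A :: "('m, 'e::convenient_space) atlas"
  assumes A: "convenient_manifold A"
    and \<theta>: "one_form A \<theta>" and \<eta>: "one_form A \<eta>" and \<omega>: "two_form A \<omega>"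
  shows "cotangent_bundle_morphism A (flat \<theta> \<eta> \<omega>)"
proof -
  have in_cotangent: "flat \<theta> \<eta> \<omega> p X \<in> cotangent_space A p"
    if "p \<in> points A" "X \<in> tangent_space A p" for p X
  proof -
    have "\<theta> p \<in> cotangent_space A p" "\<eta> p \<in> cotangent_space A p" "\<omega> p X \<in> cotangent_space A p"
      using that \<theta> \<eta> \<omega> by (auto simp: one_form_def two_form_def alternating_forms_def)
    hence "(\<lambda>Y. \<theta> p X * \<theta> p Y + \<omega> p X Y + \<eta> p X * \<eta> p Y) \<in> cotangent_space A p"
      by (intro cotangent_space_add cotangent_space_scale)
    thus ?thesis by (simp add: flat_def[abs_def])
  qed
  have linear: "flat \<theta> \<eta> \<omega> p (tangent_add A p X Y) Z = flat \<theta> \<eta> \<omega> p X Z + flat \<theta> \<eta> \<omega> p Y Z"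
      "flat \<theta> \<eta> \<omega> p (tangent_scale A p r X) Z = r * flat \<theta> \<eta> \<omega> p X Z"
    if p: "p \<in> points A" and XY: "X \<in> tangent_space A p" "Y \<in> tangent_space A p"
      and Z: "Z \<in> tangent_space A p" for p X Y Z r
  proof -
    have "\<theta> p \<in> cotangent_space A p" "\<eta> p \<in> cotangent_space A p"
      "(\<lambda>X. \<omega> p X Z) \<in> cotangent_space A p"
      using p Z \<theta> \<eta> \<omega> by (auto simp: one_form_def two_form_def alternating_forms_def)
    note lin = this[THEN cotangent_space_linear[OF p]]
    obtain x y where "X = tangent_iso A p x" "Y = tangent_iso A p y"
      using XY tangent_space_eq[OF A p] by auto
    thus "flat \<theta> \<eta> \<omega> p (tangent_add A p X Y) Z = flat \<theta> \<eta> \<omega> p X Z + flat \<theta> \<eta> \<omega> p Y Z"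
      "flat \<theta> \<eta> \<omega> p (tangent_scale A p r X) Z = r * flat \<theta> \<eta> \<omega> p X Z"
      by (simp_all add: flat_def tangent_add_iso[OF A p] tangent_scale_iso[OF A p]
          lin[THEN linear_add] lin[THEN linear_scale] algebra_simps)
  qed
  have smooth: "smooth_path_cotangent A c (\<lambda>t. flat \<theta> \<eta> \<omega> (c t) (X t))"
    if cX: "smooth_path_tangent A c X" for c X
  proof -
    have c: "smooth_path A c" using cX by (simp add: smooth_path_tangent_def)
    have cot: "smooth_path_cotangent A c (\<theta> \<circ> c)" "smooth_path_cotangent A c (\<eta> \<circ> c)"
      and alt: "smooth_path_alternating A c (\<omega> \<circ> c)"
      using \<theta> \<eta> \<omega> c by (auto simp: one_form_def two_form_def)
    show ?thesis
      unfolding smooth_path_cotangent_def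
    proof (intro conjI allI ballI, goal_cases)
      case 1
      show ?case by (fact c)
    next
      case (2 t)
      show ?case
        using c cX by (intro in_cotangent) (auto simp: smooth_path_def smooth_path_tangent_def)
    next
      case (3 k)
      obtain U u where k: "k = (U, u)" by (cases k)
      \<comment> \<open>\<open>f\<close> is the local representative of \<open>X\<close> along
        \<open>c\<close>. Reparametrised by \<open>g\<close>, it is one input of the forms; the test
        curve \<open>e\<close> is the other.\<close>
      obtain f where f: "smooth_curve_on (c -` U) f"
        "\<And>t. t \<in> c -` U \<Longrightarrow> X t = tangent_of A u (c t) (f t)"
        using cX 3 unfolding k smooth_path_tangent_def by blast
      have "smooth_curve_on J (\<lambda>s. flat \<theta> \<eta> \<omega> (c (g s)) (X (g s)) (tangent_of A u (c (g s)) (e s)))"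
        if J: "open J" "smooth_curve_on J g" "g ` J \<subseteq> c -` U" and e: "smooth_curve_on J e" for J g e
      proof -
        let ?T = "\<lambda>s. tangent_of A u (c (g s))"
        have fg: "smooth_curve_on J (\<lambda>s. f (g s))"
          using J(2) f(1) J(3) by (rule smooth_curve_on_compose)
        have "smooth_curve_on J (\<lambda>s. (\<theta> \<circ> c) (g s) (?T s (a s)))"
          "smooth_curve_on J (\<lambda>s. (\<eta> \<circ> c) (g s) (?T s (a s)))"
          if "smooth_curve_on J a" for a
          using cot[unfolded smooth_path_cotangent_def, THEN conjunct2, THEN conjunct2,
              THEN bspec[OF _ 3[unfolded k]]] J that by simp_all
        moreover have "smooth_curve_on J (\<lambda>s. (\<omega> \<circ> c) (g s) (?T s (f (g s))) (?T s (e s)))"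
          using alt[unfolded smooth_path_alternating_def, THEN conjunct2, THEN conjunct2,
              THEN bspec[OF _ 3[unfolded k]]] J e fg by simp
        ultimately have "smooth_curve_on J (\<lambda>s. flat \<theta> \<eta> \<omega> (c (g s)) (?T s (f (g s))) (?T s (e s)))"
          using e fg unfolding flat_def o_def
          by (intro smooth_curve_on_add smooth_curve_on_mult) auto
        \<comment> \<open>\<open>X (g s)\<close> is known to agree with its chart expression only
          for \<open>s\<close> in \<open>J\<close>, hence the congruence rule for open sets.\<close>
        thus ?thesis
          by (rule smooth_curve_on_cong[OF J(1), rotated]) (use f(2) J(3) in auto)
      qed
      thus ?case by (simp add: k)
    qed
  qed
  show ?thesis
    unfolding cotangent_bundle_morphism_def using in_cotangent linear smooth by simp
qed

section \<open>Linear algebra in one fibre\<close>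

text \<open>\<open>\<alpha>\<close>, \<open>\<beta>\<close> and \<open>\<omega>\<close> stand for
  \<open>\<theta>\<close>, \<open>\<eta>\<close> and \<open>d\<eta>\<close> at one point, read on
  the model space through \<open>tangent_iso\<close>.\<close>

locale forms_on_fibre =
  fixes \<alpha> \<beta> :: "'a::real_vector \<Rightarrow> real" and \<omega> :: "'a \<Rightarrow> 'a \<Rightarrow> real"
  assumes linear_left: "linear \<alpha>" and linear_right: "linear \<beta>"
    and linear_form: "linear (\<omega> x)" and linear_form': "linear (\<lambda>y. \<omega> y x)"
    and alternating: "\<omega> x x = 0"
begin

lemmas fibre_simps =
  linear_add[OF linear_left] linear_add[OF linear_right]
  linear_add[OF linear_form] linear_add[OF linear_form']
  linear_diff[OF linear_left] linear_diff[OF linear_right]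
  linear_diff[OF linear_form] linear_diff[OF linear_form']
  linear_scale[OF linear_left] linear_scale[OF linear_right]
  linear_scale[OF linear_form] linear_scale[OF linear_form']
  linear_0[OF linear_left] linear_0[OF linear_right]
  linear_0[OF linear_form] linear_0[OF linear_form']

text \<open>Polarisation: at \<open>x + y\<close> the diagonal value reduces to the sum of the two
  mixed terms.\<close>

lemma skew: "\<omega> x y = - \<omega> y x"
  using alternating[of "x + y", unfolded fibre_simps] by (simp add: alternating)

definition common_kernel_trivial :: bool where
  "common_kernel_trivial \<longleftrightarrow> (\<forall>x. \<alpha> x = 0 \<and> \<beta> x = 0 \<and> (\<forall>y. \<omega> x y = 0) \<longrightarrow> x = 0)"

lemma flat_inj_iff:
  "(\<forall>x y. (\<forall>z. \<alpha> x * \<alpha> z + \<omega> x z + \<beta> x * \<beta> z = \<alpha> y * \<alpha> z + \<omega> y z + \<beta> y * \<beta> z) \<longrightarrow> x = y)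
    \<longleftrightarrow> common_kernel_trivial" (is "?inj \<longleftrightarrow> _")
proof
  assume ?inj
  \<comment> \<open>Injectivity is used against \<open>y = 0\<close>, where the right-hand side
    vanishes.\<close>
  hence "(\<forall>z. \<alpha> x * \<alpha> z + \<omega> x z + \<beta> x * \<beta> z = 0) \<longrightarrow> x = 0" for x
    by (metis (no_types, lifting) add_0 fibre_simps(13,14,16) mult_zero_left)
  thus common_kernel_trivial by (simp add: common_kernel_trivial_def)
next
  assume triv: common_kernel_trivial
  show ?inj
  proof (intro allI impI)
    fix x y assume "\<forall>z. \<alpha> x * \<alpha> z + \<omega> x z + \<beta> x * \<beta> z = \<alpha> y * \<alpha> z + \<omega> y z + \<beta> y * \<beta> z"
    hence *: "\<alpha> (x - y) * \<alpha> z + \<omega> (x - y) z + \<beta> (x - y) * \<beta> z = 0" for z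
      by (simp add: fibre_simps left_diff_distrib) (smt (verit))
    \<comment> \<open>The choice \<open>z = x - y\<close> removes the alternating term and leaves a
      sum of two squares.\<close>
    from *[of "x - y"] have "\<alpha> (x - y) = 0" "\<beta> (x - y) = 0"
      by (simp_all add: alternating sum_squares_eq_zero_iff)
    moreover from this have "\<forall>z. \<omega> (x - y) z = 0" using * by simp
    ultimately have "x - y = 0"
      using triv unfolding common_kernel_trivial_def by blast
    thus "x = y" by simp
  qed
qed

end

section \<open>Fibres in which both restrictions of the 2-form are degenerate\<close>

locale degenerate_forms_on_fibre = forms_on_fibre +
  assumes degenerate_left: "\<exists>x. x \<noteq> 0 \<and> \<alpha> x = 0 \<and> (\<forall>y. \<omega> x y = 0)"
    and degenerate_right: "\<exists>x. x \<noteq> 0 \<and> \<beta> x = 0 \<and> (\<forall>y. \<omega> x y = 0)"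
begin

text \<open>A non-zero vector in the kernels of \<open>\<alpha>\<close> and \<open>\<omega>\<close>
  cannot also lie in that of \<open>\<beta>\<close>, so \<open>\<beta> R \<noteq> 0\<close>;
  symmetrically for \<open>S\<close>. Up to normalisation these are the Reeb vectors, and
  subtracting suitable multiples of them from \<open>x\<close> makes both 1-forms vanish.\<close>

lemma reeb:
  assumes common_kernel_trivial
  obtains R S where "\<alpha> R = 0" "\<beta> R \<noteq> 0" "\<And>y. \<omega> R y = 0" "\<alpha> S \<noteq> 0" "\<beta> S = 0" "\<And>y. \<omega> S y = 0"
    and "\<And>x. \<exists>x\<^sub>1. \<alpha> x\<^sub>1 = 0 \<and> \<beta> x\<^sub>1 = 0 \<and> x = x\<^sub>1 + (\<alpha> x / \<alpha> S) *\<^sub>R S + (\<beta> x / \<beta> R) *\<^sub>R R"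
proof -
  obtain R S where R: "R \<noteq> 0" "\<alpha> R = 0" "\<And>y. \<omega> R y = 0" and S: "S \<noteq> 0" "\<beta> S = 0" "\<And>y. \<omega> S y = 0"
    using degenerate_left degenerate_right by blast
  have nz: "\<beta> R \<noteq> 0" "\<alpha> S \<noteq> 0"
    using R S assms by (auto simp: common_kernel_trivial_def)
  have "\<exists>x\<^sub>1. \<alpha> x\<^sub>1 = 0 \<and> \<beta> x\<^sub>1 = 0 \<and> x = x\<^sub>1 + (\<alpha> x / \<alpha> S) *\<^sub>R S + (\<beta> x / \<beta> R) *\<^sub>R R" for x
    using R S nz
    by (intro exI[of _ "x - (\<alpha> x / \<alpha> S) *\<^sub>R S - (\<beta> x / \<beta> R) *\<^sub>R R"]) (simp add: fibre_simps)
  thus ?thesis using that[of R S] R S nz by blast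
qed

text \<open>If the common kernel is trivial, testing \<open>\<omega> x\<close> against vectors
  killed by \<open>\<alpha>\<close> and \<open>\<beta>\<close> decides whether
  \<open>\<omega> x\<close> vanishes: \<open>R\<close> and \<open>S\<close> span a complement and
  pair to zero with everything.\<close>

lemma weakly_nondegenerate_iff:
  "(\<forall>x. \<alpha> x = 0 \<and> \<beta> x = 0 \<longrightarrow> (\<forall>y. \<alpha> y = 0 \<and> \<beta> y = 0 \<longrightarrow> \<omega> x y = 0) \<longrightarrow> x = 0)
    \<longleftrightarrow> common_kernel_trivial" (is "?weak \<longleftrightarrow> _")
proof
  assume ?weak
  thus common_kernel_trivial by (simp add: common_kernel_trivial_def)
next
  assume triv: common_kernel_trivial
  then obtain R S where RS: "\<And>y. \<omega> R y = 0" "\<And>y. \<omega> S y = 0"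
    "\<And>x. \<exists>x\<^sub>1. \<alpha> x\<^sub>1 = 0 \<and> \<beta> x\<^sub>1 = 0 \<and> x = x\<^sub>1 + (\<alpha> x / \<alpha> S) *\<^sub>R S + (\<beta> x / \<beta> R) *\<^sub>R R"
    by (rule reeb) blast
  show ?weak
  proof (intro allI impI)
    fix x assume x: "\<alpha> x = 0 \<and> \<beta> x = 0" "\<forall>y. \<alpha> y = 0 \<and> \<beta> y = 0 \<longrightarrow> \<omega> x y = 0"
    have "\<omega> x z = 0" for z
    proof -
      obtain z\<^sub>1 where z: "\<alpha> z\<^sub>1 = 0" "\<beta> z\<^sub>1 = 0"
        "z = z\<^sub>1 + (\<alpha> z / \<alpha> S) *\<^sub>R S + (\<beta> z / \<beta> R) *\<^sub>R R"
        using RS(3) by blast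
      \<comment> \<open>\<open>R\<close> and \<open>S\<close> are known to annihilate as first
        arguments; skew-symmetry moves them there.\<close>
      have "\<omega> x z = \<omega> x z\<^sub>1"
        by (subst z(3)) (simp add: fibre_simps skew[of x R] skew[of x S] RS(1,2))
      thus ?thesis using x z by simp
    qed
    thus "x = 0" using triv x by (simp add: common_kernel_trivial_def)
  qed
qed

text \<open>A vector of the common kernel lies in all three summands, so uniqueness forces it to be
  zero. Conversely, \<open>reeb\<close> supplies a decomposition, and two decompositions differ in
  the second and third summands by vectors of the common kernel.\<close>

lemma direct_sum_iff:
  "(\<forall>x. \<exists>!(x\<^sub>1, x\<^sub>2, x\<^sub>3). (\<alpha> x\<^sub>1 = 0 \<and> \<beta> x\<^sub>1 = 0) \<and> ((\<forall>y. \<omega> x\<^sub>2 y = 0) \<and> \<beta> x\<^sub>2 = 0) \<and>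
      ((\<forall>y. \<omega> x\<^sub>3 y = 0) \<and> \<alpha> x\<^sub>3 = 0) \<and> x = x\<^sub>1 + x\<^sub>2 + x\<^sub>3)
    \<longleftrightarrow> common_kernel_trivial" (is "(\<forall>x. Ex1 (?dec x)) \<longleftrightarrow> _")
proof
  assume dec: "\<forall>x. Ex1 (?dec x)"
  show common_kernel_trivial
    unfolding common_kernel_trivial_def
  proof (intro allI impI)
    fix x assume "\<alpha> x = 0 \<and> \<beta> x = 0 \<and> (\<forall>y. \<omega> x y = 0)"
    hence "?dec x (x, 0, 0)" "?dec x (0, x, 0)" by (simp_all add: fibre_simps)
    with dec have "(x, 0, 0) = (0, x, 0 :: 'a)" by blast
    thus "x = 0" by simp
  qed
next
  assume triv: common_kernel_trivial
  then obtain R S where RS: "\<alpha> R = 0" "\<And>y. \<omega> R y = 0" "\<beta> S = 0" "\<And>y. \<omega> S y = 0"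
    "\<And>x. \<exists>x\<^sub>1. \<alpha> x\<^sub>1 = 0 \<and> \<beta> x\<^sub>1 = 0 \<and> x = x\<^sub>1 + (\<alpha> x / \<alpha> S) *\<^sub>R S + (\<beta> x / \<beta> R) *\<^sub>R R"
    by (rule reeb) blast
  show "\<forall>x. Ex1 (?dec x)"
  proof
    fix x
    obtain x\<^sub>1 where x\<^sub>1: "\<alpha> x\<^sub>1 = 0" "\<beta> x\<^sub>1 = 0"
      "x = x\<^sub>1 + (\<alpha> x / \<alpha> S) *\<^sub>R S + (\<beta> x / \<beta> R) *\<^sub>R R"
      using RS(5) by blast
    \<comment> \<open>\<open>S\<close> belongs to the second summand because
      \<open>\<beta> S = 0\<close>, and \<open>R\<close> to the third because
      \<open>\<alpha> R = 0\<close>.\<close>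
    have "?dec x (x\<^sub>1, (\<alpha> x / \<alpha> S) *\<^sub>R S, (\<beta> x / \<beta> R) *\<^sub>R R)"
      using x\<^sub>1 RS(1-4) by (simp add: fibre_simps)
    moreover have "s = t" if s: "?dec x s" and t: "?dec x t" for s t
    proof -
      obtain s\<^sub>1 s\<^sub>2 s\<^sub>3 t\<^sub>1 t\<^sub>2 t\<^sub>3 where st: "s = (s\<^sub>1, s\<^sub>2, s\<^sub>3)" "t = (t\<^sub>1, t\<^sub>2, t\<^sub>3)"
        by (metis prod_cases3)
      have eq: "s\<^sub>1 + s\<^sub>2 + s\<^sub>3 = t\<^sub>1 + t\<^sub>2 + t\<^sub>3" using s t by (simp add: st)
      have "\<alpha> s\<^sub>1 = 0" "\<beta> s\<^sub>1 = 0" "\<beta> s\<^sub>2 = 0" "\<alpha> s\<^sub>3 = 0"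
        "\<alpha> t\<^sub>1 = 0" "\<beta> t\<^sub>1 = 0" "\<beta> t\<^sub>2 = 0" "\<alpha> t\<^sub>3 = 0"
        using s t by (simp_all add: st)
      \<comment> \<open>\<open>\<alpha>\<close> vanishes on the first and third summands and
        \<open>\<beta>\<close> on the first and second, so each form sees a single
        component.\<close>
      hence "\<alpha> s\<^sub>2 = \<alpha> t\<^sub>2" "\<beta> s\<^sub>3 = \<beta> t\<^sub>3"
        using arg_cong[OF eq, of \<alpha>] arg_cong[OF eq, of \<beta>] by (simp_all add: fibre_simps)
      hence "s\<^sub>2 - t\<^sub>2 = 0" "s\<^sub>3 - t\<^sub>3 = 0"
        using s t triv unfolding common_kernel_trivial_def
        by (auto simp: st fibre_simps simp del: right_minus_eq)
      thus ?thesis using eq by (simp add: st)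
    qed
    ultimately show "Ex1 (?dec x)" unfolding Ex1_def by blast
  qed
qed

end

section \<open>Equivalence of the three conditions\<close>

text \<open>Applied to each component, \<open>T\<close> is a bijection from the triples counted on
  the right onto those on the left. For \<open>tangent_iso A p\<close> this carries unique
  decompositions over to the model space.\<close>

lemma Ex1_triple_image_iff:
  assumes "inj T"
  shows "(\<exists>!(X, Y, Z). X \<in> T ` A \<and> Y \<in> T ` B \<and> Z \<in> T ` C \<and> P X Y Z) \<longleftrightarrow>
    (\<exists>!(x, y, z). x \<in> A \<and> y \<in> B \<and> z \<in> C \<and> P (T x) (T y) (T z))" (is "Ex1 ?Q \<longleftrightarrow> Ex1 ?R")
proof -
  let ?G = "\<lambda>(x, y, z). (T x, T y, T z)"
  have Q_G: "?Q (?G t) \<longleftrightarrow> ?R t" for t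
    by (cases t) (simp add: inj_image_mem_iff[OF assms])
  have range_G: "\<exists>t. s = ?G t" if s: "?Q s" for s
  proof -
    obtain x y z where "s = (T x, T y, T z)" using s by (cases s) auto
    thus ?thesis by (intro exI[of _ "(x, y, z)"]) simp
  qed
  have inj_G: "?G s = ?G t \<longleftrightarrow> s = t" for s t
    by (cases s; cases t) (simp add: inj_eq[OF assms])
  show ?thesis
  proof
    assume "Ex1 ?Q"
    then obtain s where s: "?Q s" "\<And>s'. ?Q s' \<Longrightarrow> s' = s" by (rule ex1E) iprover
    obtain t where t: "s = ?G t" using range_G[OF s(1)] ..
    show "Ex1 ?R"
    proof (rule ex1I)
      show "?R t" using s(1) unfolding t Q_G .
      show "t' = t" if "?R t'" for t'
        using s(2)[OF Q_G[THEN iffD2, OF that]] unfolding t inj_G .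
    qed
  next
    assume "Ex1 ?R"
    then obtain t where t: "?R t" "\<And>t'. ?R t' \<Longrightarrow> t' = t" by (rule ex1E) iprover
    show "Ex1 ?Q"
    proof (rule ex1I)
      show "?Q (?G t)" using t(1) unfolding Q_G .
      fix s assume s: "?Q s"
      obtain t' where t': "s = ?G t'" using range_G[OF s] ..
      have "t' = t" using s unfolding t' Q_G by (rule t(2))
      thus "s = ?G t" by (simp add: t')
    qed
  qed
qed

theorem theorem6p6:
  fixes A :: "('m, 'e::convenient_space) atlas"
    and \<theta> \<eta> :: "'m \<Rightarrow> 'm tangent \<Rightarrow> real"
    and d\<eta> :: "'m \<Rightarrow> 'm tangent \<Rightarrow> 'm tangent \<Rightarrow> real"
    and H\<^sub>t H\<^sub>z H\<^sub>t\<^sub>z V V\<^sub>t V\<^sub>z :: "'m \<Rightarrow> 'm tangent set"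
  assumes "convenient_manifold A"
    and "closed_one_form A \<theta>"
    and "one_form A \<eta>"
    and "has_exterior_derivative A \<eta> d\<eta>"
  defines "H\<^sub>t \<equiv> ker_one_form A \<theta>"
    and "H\<^sub>z \<equiv> ker_one_form A \<eta>"
    and "H\<^sub>t\<^sub>z \<equiv> \<lambda>p. H\<^sub>t p \<inter> H\<^sub>z p"
    and "V \<equiv> ker_two_form A d\<eta>"
    and "V\<^sub>t \<equiv> \<lambda>p. V p \<inter> H\<^sub>z p"
    and "V\<^sub>z \<equiv> \<lambda>p. V p \<inter> H\<^sub>t p"
  assumes "degenerate_on A d\<eta> H\<^sub>t"
    and "degenerate_on A d\<eta> H\<^sub>z"
  shows "(tangent_direct_sum A H\<^sub>t\<^sub>z V\<^sub>t V\<^sub>z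
            \<longleftrightarrow> weakly_symplectic_distribution A H\<^sub>t\<^sub>z d\<eta>) \<and>
         (weakly_symplectic_distribution A H\<^sub>t\<^sub>z d\<eta>
            \<longleftrightarrow> injective_bundle_morphism A (flat \<theta> \<eta> d\<eta>))"
proof -
  note A = assms(1)
  have \<theta>: "one_form A \<theta>" and \<eta>: "one_form A \<eta>" and \<omega>: "two_form A d\<eta>"
    using assms(2-4) by (simp_all add: closed_one_form_def has_exterior_derivative_def)
  let ?T = "tangent_iso A"
  let ?\<alpha> = "\<lambda>p x. \<theta> p (?T p x)" and ?\<beta> = "\<lambda>p x. \<eta> p (?T p x)"
    and ?\<omega> = "\<lambda>p x y. d\<eta> p (?T p x) (?T p y)"
  note TS = tangent_space_eq[OF A] and T_inj = inj_eq[OF inj_tangent_iso[OF A]]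
    and T_simps = tangent_zero_eq[OF A] tangent_add_iso[OF A] tangent_scale_iso[OF A]
  have fibre: "degenerate_forms_on_fibre (?\<alpha> p) (?\<beta> p) (?\<omega> p)" if p: "p \<in> points A" for p
  proof (intro degenerate_forms_on_fibre.intro forms_on_fibre.intro
      degenerate_forms_on_fibre_axioms.intro)
    show "linear (?\<alpha> p)" "linear (?\<beta> p)"
      using \<theta> \<eta> p by (auto simp: one_form_def intro: cotangent_space_linear)
    show "linear (?\<omega> p x)" "linear (\<lambda>y. ?\<omega> p y x)" "?\<omega> p x x = 0" for x
      using \<omega> p cotangent_space_linear[OF p]
      by (auto simp: two_form_def alternating_forms_def TS)
    \<comment> \<open>\<open>\<alpha>\<close> is arbitrary here so that one argument serves both
      \<open>\<theta>\<close> and \<open>\<eta>\<close>.\<close>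
    have degenerate: "\<exists>x. x \<noteq> 0 \<and> \<alpha> p (?T p x) = 0 \<and> (\<forall>y. ?\<omega> p x y = 0)"
      if deg: "degenerate_on A d\<eta> (ker_one_form A \<alpha>)" for \<alpha>
    proof -
      obtain X where X: "X \<in> ker_one_form A \<alpha> p" "X \<noteq> tangent_zero A p"
        "\<forall>Y\<in>tangent_space A p. d\<eta> p X Y = 0"
        using deg p unfolding degenerate_on_def by blast
      then obtain x where "X = ?T p x" unfolding ker_one_form_def TS[OF p] by blast
      with X show ?thesis
        by (intro exI[of _ x]) (simp add: ker_one_form_def TS[OF p] T_simps[OF p] T_inj[OF p])
    qed
    show "\<exists>x. x \<noteq> 0 \<and> ?\<alpha> p x = 0 \<and> (\<forall>y. ?\<omega> p x y = 0)"
      "\<exists>x. x \<noteq> 0 \<and> ?\<beta> p x = 0 \<and> (\<forall>y. ?\<omega> p x y = 0)"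
      using degenerate assms(11,12) unfolding H\<^sub>t_def H\<^sub>z_def by simp_all
  qed
  \<comment> \<open>Each distribution is the image of a subspace of the model space; the quantifier
    over tangent vectors in \<open>ker_two_form\<close> becomes one over all model vectors.\<close>
  have D_eq:
    "H\<^sub>t\<^sub>z p = ?T p ` {x. ?\<alpha> p x = 0 \<and> ?\<beta> p x = 0}"
    "V\<^sub>t p = ?T p ` {x. (\<forall>y. ?\<omega> p x y = 0) \<and> ?\<beta> p x = 0}"
    "V\<^sub>z p = ?T p ` {x. (\<forall>y. ?\<omega> p x y = 0) \<and> ?\<alpha> p x = 0}" if "p \<in> points A" for p
    using TS[OF that]
    by (auto simp: H\<^sub>t\<^sub>z_def H\<^sub>t_def H\<^sub>z_def V\<^sub>t_def V\<^sub>z_def V_def ker_one_form_def ker_two_form_def)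
  have subspaces:
    "subspace {x. ?\<alpha> p x = 0 \<and> ?\<beta> p x = 0}"
    "subspace {x. (\<forall>y. ?\<omega> p x y = 0) \<and> ?\<beta> p x = 0}"
    "subspace {x. (\<forall>y. ?\<omega> p x y = 0) \<and> ?\<alpha> p x = 0}" if "p \<in> points A" for p
  proof -
    interpret degenerate_forms_on_fibre "?\<alpha> p" "?\<beta> p" "?\<omega> p" using that by (rule fibre)
    show "subspace {x. ?\<alpha> p x = 0 \<and> ?\<beta> p x = 0}"
      "subspace {x. (\<forall>y. ?\<omega> p x y = 0) \<and> ?\<beta> p x = 0}"
      "subspace {x. (\<forall>y. ?\<omega> p x y = 0) \<and> ?\<alpha> p x = 0}"
      by (auto simp: subspace_def fibre_simps)
  qed
  have "distribution A H\<^sub>t\<^sub>z" by (rule distributionI[OF A subspaces(1) D_eq(1)])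
  moreover have "distribution A V\<^sub>t" by (rule distributionI[OF A subspaces(2) D_eq(2)])
  moreover have "distribution A V\<^sub>z" by (rule distributionI[OF A subspaces(3) D_eq(3)])
  ultimately have distributions: "distribution A H\<^sub>t\<^sub>z" "distribution A V\<^sub>t" "distribution A V\<^sub>z" .
  let ?triv = "\<lambda>p. forms_on_fibre.common_kernel_trivial (?\<alpha> p) (?\<beta> p) (?\<omega> p)"
  have dec: "(\<forall>X\<in>tangent_space A p. \<exists>!(X\<^sub>1, X\<^sub>2, X\<^sub>3). X\<^sub>1 \<in> H\<^sub>t\<^sub>z p \<and> X\<^sub>2 \<in> V\<^sub>t p \<and> X\<^sub>3 \<in> V\<^sub>z p \<and>
        X = tangent_add A p (tangent_add A p X\<^sub>1 X\<^sub>2) X\<^sub>3) \<longleftrightarrow> ?triv p" if p: "p \<in> points A" for p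
  proof -
    interpret degenerate_forms_on_fibre "?\<alpha> p" "?\<beta> p" "?\<omega> p" using p by (rule fibre)
    have "(\<exists>!(X\<^sub>1, X\<^sub>2, X\<^sub>3). X\<^sub>1 \<in> H\<^sub>t\<^sub>z p \<and> X\<^sub>2 \<in> V\<^sub>t p \<and> X\<^sub>3 \<in> V\<^sub>z p \<and>
        ?T p x = tangent_add A p (tangent_add A p X\<^sub>1 X\<^sub>2) X\<^sub>3) \<longleftrightarrow>
      (\<exists>!(x\<^sub>1, x\<^sub>2, x\<^sub>3). (?\<alpha> p x\<^sub>1 = 0 \<and> ?\<beta> p x\<^sub>1 = 0) \<and> ((\<forall>y. ?\<omega> p x\<^sub>2 y = 0) \<and> ?\<beta> p x\<^sub>2 = 0) \<and>
        ((\<forall>y. ?\<omega> p x\<^sub>3 y = 0) \<and> ?\<alpha> p x\<^sub>3 = 0) \<and> x = x\<^sub>1 + x\<^sub>2 + x\<^sub>3)" for x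
      unfolding D_eq[OF p] Ex1_triple_image_iff[OF inj_tangent_iso[OF A p]]
        T_simps[OF p] T_inj[OF p] mem_Collect_eq ..
    thus ?thesis
      unfolding TS[OF p] direct_sum_iff[symmetric] by (simp only: ball_simps ball_UNIV)
  qed
  \<comment> \<open>Skew-symmetry and linearity come with \<open>d\<eta>\<close>, and the
    distribution clause is settled, so weak non-degeneracy in each fibre remains.\<close>
  have "weakly_symplectic_distribution A H\<^sub>t\<^sub>z d\<eta> \<longleftrightarrow> (\<forall>p\<in>points A. ?triv p)"
  proof -
    have "(\<forall>X\<in>H\<^sub>t\<^sub>z p. \<forall>Y\<in>H\<^sub>t\<^sub>z p. d\<eta> p X Y = - d\<eta> p Y X) \<and>
        (\<forall>X\<in>H\<^sub>t\<^sub>z p. \<forall>Y\<in>H\<^sub>t\<^sub>z p. \<forall>Z\<in>H\<^sub>t\<^sub>z p. d\<eta> p (tangent_add A p X Y) Z = d\<eta> p X Z + d\<eta> p Y Z) \<and>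
        (\<forall>X\<in>H\<^sub>t\<^sub>z p. \<forall>Z\<in>H\<^sub>t\<^sub>z p. \<forall>r. d\<eta> p (tangent_scale A p r X) Z = r * d\<eta> p X Z) \<and>
        (\<forall>X\<in>H\<^sub>t\<^sub>z p. (\<forall>Y\<in>H\<^sub>t\<^sub>z p. d\<eta> p X Y = 0) \<longrightarrow> X = tangent_zero A p) \<longleftrightarrow> ?triv p"
      if p: "p \<in> points A" for p
    proof -
      interpret degenerate_forms_on_fibre "?\<alpha> p" "?\<beta> p" "?\<omega> p" using p by (rule fibre)
      have "\<forall>X\<in>H\<^sub>t\<^sub>z p. \<forall>Y\<in>H\<^sub>t\<^sub>z p. d\<eta> p X Y = - d\<eta> p Y X"
        unfolding D_eq(1)[OF p] by clarify (rule skew)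
      moreover have
        "\<forall>X\<in>H\<^sub>t\<^sub>z p. \<forall>Y\<in>H\<^sub>t\<^sub>z p. \<forall>Z\<in>H\<^sub>t\<^sub>z p. d\<eta> p (tangent_add A p X Y) Z = d\<eta> p X Z + d\<eta> p Y Z"
        "\<forall>X\<in>H\<^sub>t\<^sub>z p. \<forall>Z\<in>H\<^sub>t\<^sub>z p. \<forall>r. d\<eta> p (tangent_scale A p r X) Z = r * d\<eta> p X Z"
        unfolding D_eq(1)[OF p] by (simp_all add: T_simps[OF p] fibre_simps)
      moreover have "(\<forall>X\<in>H\<^sub>t\<^sub>z p. (\<forall>Y\<in>H\<^sub>t\<^sub>z p. d\<eta> p X Y = 0) \<longrightarrow> X = tangent_zero A p) \<longleftrightarrow> ?triv p"
        unfolding weakly_nondegenerate_iff[symmetric] D_eq(1)[OF p]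
        by (simp add: T_simps[OF p] T_inj[OF p])
      ultimately show ?thesis by argo
    qed
    thus ?thesis
      unfolding weakly_symplectic_distribution_def using distributions(1) by simp
  qed
  moreover have "tangent_direct_sum A H\<^sub>t\<^sub>z V\<^sub>t V\<^sub>z \<longleftrightarrow> (\<forall>p\<in>points A. ?triv p)"
    unfolding tangent_direct_sum_def using distributions dec by simp
  \<comment> \<open>\<open>cotangent_bundle_morphism_flat\<close> provides the morphism property,
    which leaves injectivity in each fibre.\<close>
  moreover have "injective_bundle_morphism A (flat \<theta> \<eta> d\<eta>) \<longleftrightarrow> (\<forall>p\<in>points A. ?triv p)"
  proof -
    have "(\<forall>X\<in>tangent_space A p. \<forall>Y\<in>tangent_space A p.
        (\<forall>Z\<in>tangent_space A p. flat \<theta> \<eta> d\<eta> p X Z = flat \<theta> \<eta> d\<eta> p Y Z) \<longrightarrow> X = Y) \<longleftrightarrow> ?triv p"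
      if p: "p \<in> points A" for p
    proof -
      interpret degenerate_forms_on_fibre "?\<alpha> p" "?\<beta> p" "?\<omega> p" using p by (rule fibre)
      show ?thesis
        unfolding flat_inj_iff[symmetric] TS[OF p] by (simp add: flat_def T_inj[OF p])
    qed
    thus ?thesis
      unfolding injective_bundle_morphism_def
      using cotangent_bundle_morphism_flat[OF A \<theta> \<eta> \<omega>] by simp
  qed
  ultimately show ?thesis by blast
qed

end
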